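(* Let $t,k\ge 1$ be integers, let $\delta_1,\dots,\delta_k$ be pairwise distinct nonnegative integers and let $n_1,\dots,n_k$ be positive integers. Let $\mathcal{T}$ be the set of all vectors $x=(x_1,\dots,x_k)$ of nonnegative integers with $\sum_{i=1}^k x_i=t$. The degree sequence of length $n_1+\cdots+n_k$ consisting of exactly $n_i$ terms equal to $\delta_i$ for each $i\in\{1,\dots,k\}$ is $t$-hypergraphical if and only if there exist integers $(y_x)_{x\in\mathcal{T}}$ such that $$\sum_{x\in\mathcal{T}} x_i\,y_x = n_i\delta_i\quad\text{for all } i\in\{1,\dots,k\}$$ and $$0\le y_x\le \prod_{i=1}^k\binom{n_i}{x_i}\quad\text{for all } x\in\mathcal{T}.$$
   Context: A $t$-uniform hypergraph is a pair $H=(V,E)$ where $V$ is a finite set and $E\subseteq\binom{V}{t}$ (a set of $t$-element subsets of $V$, so no repeated hyperedges). The degree of a vertex $v$ is the number of hyperedges $e\in E$ with $v\in e$. A sequence $d=(d_1,\dots,d_n)$ of nonnegative integers is $t$-hypergraphical if there is a $t$-uniform hypergraph with vertex set $\{v_1,\dots,v_n\}$ in which $v_i$ has degree $d_i$ for all $i$. The convention $\binom{n}{m}=0$ for $m>n$ is used. *)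

theory Defs
  imports Complex_Main "HOL-Library.FuncSet"
begin

definition uniform_hypergraph :: "nat \<Rightarrow> 'v set \<Rightarrow> 'v set set \<Rightarrow> bool" where
  "uniform_hypergraph t V E \<longleftrightarrow> finite V \<and> E \<subseteq> {e. e \<subseteq> V \<and> card e = t}"

definition hypergraph_degree :: "'v set set \<Rightarrow> 'v \<Rightarrow> nat" where
  "hypergraph_degree E v = card {e \<in> E. v \<in> e}"

text \<open>A sequence is a list; the vertices are its positions \<open>0, \<dots>, length d - 1\<close>.\<close>

definition hypergraphical :: "nat \<Rightarrow> nat list \<Rightarrow> bool" where
  "hypergraphical t d \<longleftrightarrow>
     (\<exists>E. uniform_hypergraph t {..<length d} E \<and>
          (\<forall>i<length d. hypergraph_degree E i = d ! i))"

text \<open>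
  Vectors \<open>(x\<^sub>1, \<dots>, x\<^sub>k)\<close> are extensional functions on \<open>{1..k}\<close> (equal to
  \<open>undefined\<close> elsewhere), so that each vector is represented exactly once and the
  set below is finite.
\<close>

definition weak_compositions :: "nat \<Rightarrow> nat \<Rightarrow> (nat \<Rightarrow> nat) set" where
  "weak_compositions k t = {x \<in> {1..k} \<rightarrow>\<^sub>E UNIV. (\<Sum>i=1..k. x i) = t}"

lemma finite_weak_compositions: "finite (weak_compositions k t)"
proof (rule finite_subset)
  show "weak_compositions k t \<subseteq> {1..k} \<rightarrow>\<^sub>E {..t}"
    unfolding weak_compositions_def
    by (auto simp: PiE_iff extensional_def intro!: member_le_sum)
  show "finite ({1..k} \<rightarrow>\<^sub>E {..t})"
    by (intro finite_PiE) auto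
qed

end

theory Submission
  imports Defs "HOL-Library.Disjoint_Sets"
begin

text \<open>
  Group the vertices into the classes \<open>C i\<close> of prescribed degree \<open>\<delta> i\<close>, and let the type of an edge
  record how many vertices it has in each class. The numbers of edges of each type of a hypergraph
  give a solution \<open>y\<close>, by double counting. Conversely, choose \<open>y x\<close> arbitrary edges of type \<open>x\<close> for
  each \<open>x\<close>; then every class has the right degree sum. Among all hypergraphs with the same numbers of
  edges of each type take one that minimises the sum of the squared degrees. If two vertices
  \<open>u, v\<close> of the same class had \<open>deg u \<ge> deg v + 2\<close>, replacing \<open>u\<close> by \<open>v\<close> in a suitable edge would
  decrease that sum. So degrees within a class differ by at most 1, and since their average
  is an integer they are all equal.
\<close>

section \<open>Degrees: double counting and exchange of edges\<close>

lemma hypergraph_degree_eq_sum: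
  assumes "finite E"
  shows "hypergraph_degree E v = (\<Sum>e\<in>E. of_bool (v \<in> e))"
  using assms by (simp add: hypergraph_degree_def sum.If_cases of_bool_def Int_def)

lemma sum_hypergraph_degree:
  assumes "finite E" "finite A"
  shows "(\<Sum>v\<in>A. hypergraph_degree E v) = (\<Sum>e\<in>E. card (e \<inter> A))"
proof -
  have "(\<Sum>v\<in>A. hypergraph_degree E v) = (\<Sum>e\<in>E. \<Sum>v\<in>A. of_bool (v \<in> e))"
    using assms by (simp only: hypergraph_degree_eq_sum sum.swap[of _ E A])
  also have "\<dots> = (\<Sum>e\<in>E. card (e \<inter> A))"
    using assms by (intro sum.cong) (auto simp: of_bool_def sum.If_cases Int_def conj_commute)
  finally show ?thesis .
qed

lemma sum_exchange:
  fixes g :: "'a \<Rightarrow> 'b::comm_monoid_add"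
  assumes "finite E" "e \<in> E" "e' \<notin> E"
  shows "sum g (insert e' (E - {e})) + g e = sum g E + g e'"
  using assms by (simp add: sum.remove[of E e] ac_simps)

text \<open>Edges containing both vertices contribute equally to both degrees. If every exchange
  landed in \<open>E\<close>, it would inject the edges with only \<open>u\<close> into those with
  only \<open>v\<close>, contradicting the larger degree of \<open>u\<close>.\<close>

lemma exists_exchangeable_edge:
  assumes "finite E" and "hypergraph_degree E v < hypergraph_degree E u"
  obtains e where "e \<in> E" "u \<in> e" "v \<notin> e" "insert v (e - {u}) \<notin> E"
proof -
  let ?U = "{e \<in> E. u \<in> e \<and> v \<notin> e}" and ?W = "{e \<in> E. v \<in> e \<and> u \<notin> e}"
    and ?B = "{e \<in> E. u \<in> e \<and> v \<in> e}"
  have "\<exists>e\<in>?U. insert v (e - {u}) \<notin> E"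
  proof (rule ccontr)
    assume "\<not> ?thesis"
    moreover have "u \<noteq> v" using assms by auto
    ultimately have "(\<lambda>e. insert v (e - {u})) ` ?U \<subseteq> ?W" by auto
    moreover have "inj_on (\<lambda>e. insert v (e - {u})) ?U"
      by (rule inj_on_inverseI[where g = "\<lambda>e. insert u (e - {v})"]) auto
    ultimately have "card ?U \<le> card ?W"
      using assms(1) by (intro card_inj_on_le) auto
    moreover have "hypergraph_degree E u = card ?U + card ?B"
      unfolding hypergraph_degree_def using assms(1)
      by (subst card_Un_disjoint[symmetric]) (auto intro!: arg_cong[where f = card])
    moreover have "hypergraph_degree E v = card ?W + card ?B"
      unfolding hypergraph_degree_def using assms(1)
      by (subst card_Un_disjoint[symmetric]) (auto intro!: arg_cong[where f = card])
    ultimately show False using assms(2) by simp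
  qed
  then show ?thesis using that by blast
qed

text \<open>A value below \<open>m\<close> forces all values to be at most \<open>m\<close>, which
  makes the sum too small; a value above \<open>m\<close> makes it too large in the same
  way.\<close>

lemma eq_average_if_differences_le_1:
  fixes f :: "'a \<Rightarrow> nat"
  assumes "finite A" and close: "\<And>u v. u \<in> A \<Longrightarrow> v \<in> A \<Longrightarrow> f u \<le> f v + 1"
    and sum: "sum f A = card A * m" and "u \<in> A"
  shows "f u = m"
proof (rule ccontr)
  assume "f u \<noteq> m"
  then consider "f u < m" | "f u > m" by linarith
  then show False
  proof cases
    case 1
    then have "f v \<le> m" if "v \<in> A" for v using close[OF that \<open>u \<in> A\<close>] by simp
    then have "sum f A < (\<Sum>v\<in>A. m)"
      using 1 assms by (intro sum_strict_mono_ex1) auto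
    then show False using sum by simp
  next
    case 2
    then have "m \<le> f v" if "v \<in> A" for v using close[OF \<open>u \<in> A\<close> that] by simp
    then have "(\<Sum>v\<in>A. m) < sum f A"
      using 2 assms by (intro sum_strict_mono_ex1) auto
    then show False using sum by simp
  qed
qed

section \<open>Edge types\<close>

text \<open>The restriction to \<open>I\<close> makes types extensional, so that they can be members
  of \<open>weak_compositions\<close>.\<close>

definition edge_type :: "'i set \<Rightarrow> ('i \<Rightarrow> 'v set) \<Rightarrow> 'v set \<Rightarrow> 'i \<Rightarrow> nat" where
  "edge_type I C e = (\<lambda>i\<in>I. card (e \<inter> C i))"

lemma edge_type_exchange:
  assumes fin: "\<And>i. i \<in> I \<Longrightarrow> finite (C i)"
    and disj: "disjoint_family_on C I"
    and "j \<in> I" "u \<in> C j" "v \<in> C j" "u \<in> e" "v \<notin> e"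
  shows "edge_type I C (insert v (e - {u})) = edge_type I C e"
proof -
  have "card (insert v (e - {u}) \<inter> C i) = card (e \<inter> C i)" if "i \<in> I" for i
  proof (cases "i = j")
    case True
    then have "insert v (e - {u}) \<inter> C i = insert v ((e \<inter> C i) - {u})"
      using assms by auto
    \<comment> \<open>Removing \<open>u\<close> and adding \<open>v\<close> gives cardinality
      \<open>card (e \<inter> C i) - 1 + 1\<close>; positivity keeps the natural subtraction
      exact.\<close>
    moreover have "0 < card (e \<inter> C i)"
      using assms True by (auto simp: card_gt_0_iff)
    ultimately show ?thesis using assms True by (simp add: card_Diff_singleton)
  next
    case False
    then have "u \<notin> C i" "v \<notin> C i"
      using assms that unfolding disjoint_family_on_def by blast+
    then have "insert v (e - {u}) \<inter> C i = e \<inter> C i" by auto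
    then show ?thesis by simp
  qed
  then show ?thesis by (auto simp: edge_type_def)
qed

text \<open>An edge of type \<open>x\<close> amounts to independent choices of an
  \<open>x i\<close>-subset of each class: taking the union and intersecting with the classes are
  mutually inverse.\<close>

lemma card_edges_of_type:
  assumes "finite I" and fin: "\<And>i. i \<in> I \<Longrightarrow> finite (C i)"
    and disj: "disjoint_family_on C I" and "x \<in> extensional I"
  shows "card {e. e \<subseteq> (\<Union>i\<in>I. C i) \<and> edge_type I C e = x} = (\<Prod>i\<in>I. card (C i) choose x i)"
proof -
  let ?P = "PiE I (\<lambda>i. {s. s \<subseteq> C i \<and> card s = x i})"
  let ?Q = "{e. e \<subseteq> (\<Union>i\<in>I. C i) \<and> edge_type I C e = x}"
  have restr: "(\<Union>j\<in>I. f j) \<inter> C i = f i" if "f \<in> ?P" "i \<in> I" for f i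
  proof -
    have sub: "f j \<subseteq> C j" if "j \<in> I" for j using \<open>f \<in> ?P\<close> that by (auto simp: PiE_iff)
    have "f j \<inter> C i = {}" if "j \<in> I" "j \<noteq> i" for j
      using sub[OF \<open>j \<in> I\<close>] disjoint_family_onD[OF disj \<open>j \<in> I\<close> \<open>i \<in> I\<close> \<open>j \<noteq> i\<close>] by blast
    then show ?thesis using sub[OF \<open>i \<in> I\<close>] \<open>i \<in> I\<close> by blast
  qed
  have "bij_betw (\<lambda>f. \<Union>i\<in>I. f i) ?P ?Q"
  proof (rule bij_betw_byWitness[where f' = "\<lambda>e. \<lambda>i\<in>I. e \<inter> C i"])
    show "\<forall>f\<in>?P. (\<lambda>i\<in>I. (\<Union>j\<in>I. f j) \<inter> C i) = f"
    proof
      fix f assume f: "f \<in> ?P"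
      show "(\<lambda>i\<in>I. (\<Union>j\<in>I. f j) \<inter> C i) = f"
      proof
        fix i show "(\<lambda>i\<in>I. (\<Union>j\<in>I. f j) \<inter> C i) i = f i"
          using restr[OF f, of i] PiE_arb[OF f, of i] by simp
      qed
    qed
    show "\<forall>e\<in>?Q. (\<Union>i\<in>I. (\<lambda>i\<in>I. e \<inter> C i) i) = e" by auto
    show "(\<lambda>f. \<Union>i\<in>I. f i) ` ?P \<subseteq> ?Q"
    proof (rule image_subsetI)
      fix f assume f: "f \<in> ?P"
      have "edge_type I C (\<Union>i\<in>I. f i) = x"
      proof
        fix i show "edge_type I C (\<Union>i\<in>I. f i) i = x i"
          using restr[OF f, of i] PiE_mem[OF f, of i] \<open>x \<in> extensional I\<close>
          by (auto simp: edge_type_def extensional_def)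
      qed
      moreover have "(\<Union>i\<in>I. f i) \<subseteq> (\<Union>i\<in>I. C i)" using PiE_mem[OF f] by blast
      ultimately show "(\<Union>i\<in>I. f i) \<in> ?Q" by simp
    qed
    show "(\<lambda>e. \<lambda>i\<in>I. e \<inter> C i) ` ?Q \<subseteq> ?P" by (auto simp: edge_type_def)
  qed
  then have "card ?Q = card ?P" by (simp add: bij_betw_same_card)
  also have "\<dots> = (\<Prod>i\<in>I. card (C i) choose x i)"
    using assms by (simp add: card_PiE n_subsets)
  finally show ?thesis .
qed

section \<open>Balancing the degrees within each class\<close>

text \<open>Uniformity is not tracked here: the size of an edge is the sum of the entries of its
  type, so preserving the type counts preserves it.\<close>

lemma exists_balanced_hypergraph:
  assumes "finite I" and fin: "\<And>i. i \<in> I \<Longrightarrow> finite (C i)"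
    and disj: "disjoint_family_on C I" and "E \<subseteq> Pow (\<Union>i\<in>I. C i)"
  obtains E' where "E' \<subseteq> Pow (\<Union>i\<in>I. C i)"
    "\<And>x. card {e \<in> E'. edge_type I C e = x} = card {e \<in> E. edge_type I C e = x}"
    "\<And>i u v. i \<in> I \<Longrightarrow> u \<in> C i \<Longrightarrow> v \<in> C i \<Longrightarrow> hypergraph_degree E' u \<le> hypergraph_degree E' v + 1"
proof -
  let ?V = "\<Union>i\<in>I. C i"
  let ?num = "\<lambda>F x. card {e \<in> F. edge_type I C e = x}"
  let ?adm = "\<lambda>F. F \<subseteq> Pow ?V \<and> (\<forall>x. ?num F x = ?num E x)"
  let ?sq = "\<lambda>F. \<Sum>w\<in>?V. (hypergraph_degree F w)\<^sup>2"
  have finV: "finite ?V" using assms by auto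
  have num_sum: "?num F x = (\<Sum>e\<in>F. of_bool (edge_type I C e = x))" if "finite F" for F x
    using that by (simp add: sum.If_cases of_bool_def Int_def)
  \<comment> \<open>A minimiser exists because \<open>?sq\<close> takes natural values and
    \<open>E\<close> itself is admissible.\<close>
  obtain F where F: "?adm F" and least: "\<And>G. ?adm G \<Longrightarrow> ?sq F \<le> ?sq G"
    using ex_has_least_nat[of ?adm E ?sq] assms(4) by blast
  have finF: "finite F" using F finV by (meson finite_Pow_iff finite_subset)
  have "hypergraph_degree F u \<le> hypergraph_degree F v + 1"
    if i: "i \<in> I" and u: "u \<in> C i" and v: "v \<in> C i" for i u v
  proof (rule ccontr)
    let ?d = "hypergraph_degree F"
    assume gt: "\<not> ?d u \<le> ?d v + 1"
    then obtain e where e: "e \<in> F" "u \<in> e" "v \<notin> e" "insert v (e - {u}) \<notin> F"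
      using exists_exchangeable_edge[OF finF, of v u] by auto
    define e' where "e' = insert v (e - {u})"
    define G where "G = insert e' (F - {e})"
    have finG: "finite G" using finF by (simp add: G_def)
    have type: "edge_type I C e' = edge_type I C e"
      unfolding e'_def using edge_type_exchange[OF fin disj i u v] e by simp
    \<comment> \<open>Both type counts and degrees are sums of indicators over the edges, so this
      one identity tracks their change.\<close>
    have exch: "sum g G + g e = sum g F + g e'" for g :: "'b set \<Rightarrow> nat"
      unfolding G_def using sum_exchange[OF finF e(1), of e'] e(4) by (simp add: e'_def)
    have "?num G x = ?num F x" for x
      unfolding num_sum[OF finF] num_sum[OF finG]
      using exch[of "\<lambda>e. of_bool (edge_type I C e = x)"] type by simp
    moreover have "e' \<subseteq> ?V" using F e i v by (auto simp: e'_def)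
    ultimately have "?adm G" using F by (auto simp: G_def)
    have deg: "hypergraph_degree G w + of_bool (w \<in> e) = ?d w + of_bool (w \<in> e')" for w
      unfolding hypergraph_degree_eq_sum[OF finF] hypergraph_degree_eq_sum[OF finG] by (rule exch)
    have "u \<noteq> v" using e by auto
    have du: "?d u = hypergraph_degree G u + 1"
      using deg[of u] e \<open>u \<noteq> v\<close> by (simp add: e'_def)
    have dv: "hypergraph_degree G v = ?d v + 1"
      using deg[of v] e by (simp add: e'_def)
    have rest: "(\<Sum>w\<in>?V - {u, v}. (hypergraph_degree G w)\<^sup>2) = (\<Sum>w\<in>?V - {u, v}. (?d w)\<^sup>2)"
    proof (rule sum.cong)
      fix w assume "w \<in> ?V - {u, v}"
      then show "(hypergraph_degree G w)\<^sup>2 = (?d w)\<^sup>2" using deg[of w] by (simp add: e'_def)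
    qed simp
    have split: "(\<Sum>w\<in>?V. h w) = h u + h v + (\<Sum>w\<in>?V - {u, v}. h w)" for h :: "'b \<Rightarrow> nat"
    proof -
      have "{u, v} \<subseteq> ?V" using i u v by auto
      then show ?thesis
        using sum.subset_diff[of "{u, v}" ?V h] finV \<open>u \<noteq> v\<close> by (simp add: add.commute)
    qed
    \<comment> \<open>With \<open>b = ?d v\<close>, the degrees of \<open>u\<close> and
      \<open>v\<close> change from \<open>b + 2 + r\<close> and \<open>b\<close> to
      \<open>b + 1 + r\<close> and \<open>b + 1\<close>. The sum of their squares drops by
      \<open>2 * r + 2\<close>.\<close>
    define r where "r = hypergraph_degree G u - hypergraph_degree G v"
    have "hypergraph_degree G u = ?d v + 1 + r"
      using gt du dv by (simp add: r_def)
    then have "(hypergraph_degree G u)\<^sup>2 + (hypergraph_degree G v)\<^sup>2 < (?d u)\<^sup>2 + (?d v)\<^sup>2"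
      unfolding du dv by (simp add: power2_eq_square algebra_simps)
    then have "?sq G < ?sq F" unfolding split rest by simp
    then show False using least[OF \<open>?adm G\<close>] by simp
  qed
  then show ?thesis using that[of F] F by blast
qed

section \<open>Uniformity and class degree sums in terms of types\<close>

lemma edge_type_in_weak_compositions_iff:
  assumes "\<And>i. i \<in> {1..k} \<Longrightarrow> finite (C i)" and "disjoint_family_on C {1..k}"
    and "e \<subseteq> (\<Union>i\<in>{1..k}. C i)"
  shows "edge_type {1..k} C e \<in> weak_compositions k t \<longleftrightarrow> card e = t"
proof -
  have "e = (\<Union>i\<in>{1..k}. e \<inter> C i)" using assms(3) by auto
  also have "card \<dots> = (\<Sum>i=1..k. card (e \<inter> C i))"
    using assms(1,2) by (intro card_UN_disjoint) (auto simp: disjoint_family_on_def)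
  finally have "card e = (\<Sum>i=1..k. card (e \<inter> C i))" .
  then show ?thesis by (simp add: weak_compositions_def edge_type_def)
qed

text \<open>Count the incidences between \<open>C i\<close> and \<open>E\<close> edge by edge, then
  group the edges by type; types in \<open>T\<close> that do not occur contribute 0.\<close>

lemma sum_hypergraph_degree_by_type:
  assumes "finite E" "finite T" "finite (C i)" "i \<in> I" and "edge_type I C ` E \<subseteq> T"
  shows "(\<Sum>v\<in>C i. hypergraph_degree E v) = (\<Sum>x\<in>T. x i * card {e \<in> E. edge_type I C e = x})"
proof -
  have "(\<Sum>v\<in>C i. hypergraph_degree E v) = (\<Sum>e\<in>E. edge_type I C e i)"
    using assms by (simp add: sum_hypergraph_degree edge_type_def)
  also have "\<dots> = (\<Sum>x\<in>T. \<Sum>e | e \<in> E \<and> edge_type I C e = x. edge_type I C e i)"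
    using assms by (intro sum.group[symmetric]) auto
  also have "\<dots> = (\<Sum>x\<in>T. x i * card {e \<in> E. edge_type I C e = x})"
    by (intro sum.cong) auto
  finally show ?thesis .
qed

theorem lemma4:
  fixes t k :: nat and \<delta> n :: "nat \<Rightarrow> nat" and d :: "nat list"
  assumes "t \<ge> 1" and "k \<ge> 1"
    and "inj_on \<delta> {1..k}"
    and "\<And>i. i \<in> {1..k} \<Longrightarrow> n i \<ge> 1"
    and "length d = (\<Sum>i=1..k. n i)"
    and "\<And>i. i \<in> {1..k} \<Longrightarrow> count_list d (\<delta> i) = n i"
  shows "hypergraphical t d \<longleftrightarrow>
    (\<exists>y :: (nat \<Rightarrow> nat) \<Rightarrow> int.
       (\<forall>i\<in>{1..k}. (\<Sum>x\<in>weak_compositions k t. int (x i) * y x) = int (n i * \<delta> i)) \<and>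
       (\<forall>x\<in>weak_compositions k t. 0 \<le> y x \<and> y x \<le> int (\<Prod>i=1..k. n i choose x i)))"
proof -
  define I where "I = {1..k}"
  define T where "T = weak_compositions k t"
  define C where "C i = {v. v < length d \<and> \<delta> i = d ! v}" for i
  define V where "V = {..<length d}"
  let ?ty = "edge_type I C"
  have finC: "finite (C i)" for i by (simp add: C_def)
  have cardC: "card (C i) = n i" if "i \<in> I" for i
    using assms(6)[of i] that
    by (simp add: C_def I_def count_list_eq_length_filter length_filter_conv_card)
  have disj: "disjoint_family_on C I"
    using inj_onD[OF assms(3)] unfolding disjoint_family_on_def C_def I_def by fastforce
  \<comment> \<open>Together the disjoint classes have as many elements as there are positions, so
    they exhaust \<open>V\<close>: every entry of \<open>d\<close> is some
    \<open>\<delta> i\<close>.\<close>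
  have "card (\<Union>i\<in>I. C i) = (\<Sum>i\<in>I. card (C i))"
    using disj finC by (intro card_UN_disjoint) (simp_all add: disjoint_family_on_def I_def)
  also have "\<dots> = card V" using assms(5) by (simp add: cardC V_def I_def)
  finally have V: "(\<Union>i\<in>I. C i) = V"
    by (intro card_subset_eq) (auto simp: C_def V_def)
  have finT: "finite T" by (simp add: T_def finite_weak_compositions)
  have type_in_T: "?ty e \<in> T \<longleftrightarrow> card e = t" if "e \<subseteq> V" for e
    using edge_type_in_weak_compositions_iff[of k C e t] finC disj that V by (simp add: I_def T_def)
  have card_type: "card {e. e \<subseteq> V \<and> ?ty e = x} = (\<Prod>i\<in>I. n i choose x i)" if "x \<in> T" for x
  proof -
    have "x \<in> extensional I" using that by (auto simp: T_def weak_compositions_def I_def PiE_def)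
    then show ?thesis
      using card_edges_of_type[of I C x] finC disj V by (simp add: cardC I_def)
  qed
  show ?thesis
    unfolding T_def[symmetric] I_def[symmetric]
  proof
    assume "hypergraphical t d"
    then obtain E where E: "E \<subseteq> {e. e \<subseteq> V \<and> card e = t}"
      and deg: "\<And>v. v < length d \<Longrightarrow> hypergraph_degree E v = d ! v"
      unfolding hypergraphical_def uniform_hypergraph_def V_def by blast
    have finE: "finite E" using finite_subset[OF E] by (simp add: V_def)
    have types: "?ty ` E \<subseteq> T" using E type_in_T by blast
    define y where "y x = int (card {e \<in> E. ?ty e = x})" for x
    have "(\<Sum>x\<in>T. int (x i) * y x) = int (n i * \<delta> i)" if i: "i \<in> I" for i
    proof -
      have "(\<Sum>x\<in>T. int (x i) * y x) = int (\<Sum>v\<in>C i. hypergraph_degree E v)"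
        using sum_hypergraph_degree_by_type[of E T C i I] types finE finT finC i by (simp add: y_def)
      also have "(\<Sum>v\<in>C i. hypergraph_degree E v) = (\<Sum>v\<in>C i. \<delta> i)"
        by (intro sum.cong) (auto simp: C_def deg)
      finally show ?thesis using cardC[OF i] by simp
    qed
    moreover have "y x \<le> int (\<Prod>i\<in>I. n i choose x i)" if "x \<in> T" for x
      unfolding y_def card_type[OF that, symmetric] using E
      by (intro of_nat_mono card_mono) (auto simp: V_def)
    ultimately show "\<exists>y. (\<forall>i\<in>I. (\<Sum>x\<in>T. int (x i) * y x) = int (n i * \<delta> i)) \<and>
        (\<forall>x\<in>T. 0 \<le> y x \<and> y x \<le> int (\<Prod>i\<in>I. n i choose x i))"
      by (intro exI[of _ y]) (auto simp: y_def)
  next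
    assume "\<exists>y. (\<forall>i\<in>I. (\<Sum>x\<in>T. int (x i) * y x) = int (n i * \<delta> i)) \<and>
        (\<forall>x\<in>T. 0 \<le> y x \<and> y x \<le> int (\<Prod>i\<in>I. n i choose x i))"
    then obtain y where y: "\<And>i. i \<in> I \<Longrightarrow> (\<Sum>x\<in>T. int (x i) * y x) = int (n i * \<delta> i)"
      and y_ge: "\<And>x. x \<in> T \<Longrightarrow> 0 \<le> y x"
      and y_le: "\<And>x. x \<in> T \<Longrightarrow> y x \<le> int (\<Prod>i\<in>I. n i choose x i)"
      by blast
    have "\<exists>S \<subseteq> {e. e \<subseteq> V \<and> ?ty e = x}. card S = nat (y x)" if "x \<in> T" for x
    proof -
      have "nat (y x) \<le> card {e. e \<subseteq> V \<and> ?ty e = x}"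
        using y_le[OF that] unfolding card_type[OF that] by (simp only: nat_le_iff)
      then show ?thesis by (rule obtain_subset_with_card_n) blast
    qed
    then obtain S where S: "\<And>x. x \<in> T \<Longrightarrow> S x \<subseteq> {e. e \<subseteq> V \<and> ?ty e = x}"
      and cardS: "\<And>x. x \<in> T \<Longrightarrow> card (S x) = nat (y x)"
      by metis
    define E where "E = (\<Union>x\<in>T. S x)"
    \<comment> \<open>Sets \<open>S x\<close> for distinct \<open>x\<close> share no edge, so each
      is recovered from the union by its type.\<close>
    have E_type: "{e \<in> E. ?ty e = x} = (if x \<in> T then S x else {})" for x
      using S by (auto simp: E_def)
    have "E \<subseteq> Pow (\<Union>i\<in>I. C i)" unfolding V using S by (auto simp: E_def)
    then obtain E' where E': "E' \<subseteq> Pow V"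
      and num: "\<And>x. card {e \<in> E'. ?ty e = x} = card {e \<in> E. ?ty e = x}"
      and close: "\<And>i u v. i \<in> I \<Longrightarrow> u \<in> C i \<Longrightarrow> v \<in> C i \<Longrightarrow>
        hypergraph_degree E' u \<le> hypergraph_degree E' v + 1"
      using exists_balanced_hypergraph[of I C E] finC disj V by (auto simp: I_def)
    have finE': "finite E'" using finite_subset[OF E'] by (simp add: V_def)
    \<comment> \<open>A type occurring in \<open>E'\<close> has a positive count, hence also occurs
      in \<open>E\<close>, whose types all lie in \<open>T\<close>.\<close>
    have types: "?ty e \<in> T" if "e \<in> E'" for e
    proof -
      have "card {a \<in> E'. ?ty a = ?ty e} > 0"
        using that finE' by (auto simp: card_gt_0_iff)
      then show ?thesis unfolding num E_type by (auto split: if_splits)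
    qed
    have "hypergraph_degree E' v = d ! v" if "v < length d" for v
    proof -
      have "v \<in> (\<Union>i\<in>I. C i)" unfolding V using that by (simp add: V_def)
      then obtain i where i: "i \<in> I" and v: "v \<in> C i" by (rule UN_E)
      \<comment> \<open>Nonnegativity of \<open>y x\<close> turns the edge count
        \<open>nat (y x)\<close> back into \<open>y x\<close>.\<close>
      have "int (\<Sum>v\<in>C i. hypergraph_degree E' v) = (\<Sum>x\<in>T. int (x i) * y x)"
        using sum_hypergraph_degree_by_type[of E' T C i I] types finE' finT finC i
        by (simp add: image_subset_iff num E_type cardS y_ge)
      also have "\<dots> = int (card (C i) * \<delta> i)" using y[OF i] cardC[OF i] by simp
      finally have "(\<Sum>v\<in>C i. hypergraph_degree E' v) = card (C i) * \<delta> i" by (simp only: of_nat_eq_iff)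
      then have "hypergraph_degree E' v = \<delta> i"
        by (intro eq_average_if_differences_le_1[OF finC close[OF i] _ v])
      then show ?thesis using v by (simp add: C_def)
    qed
    moreover have "E' \<subseteq> {e. e \<subseteq> V \<and> card e = t}" using E' types type_in_T by blast
    ultimately show "hypergraphical t d"
      unfolding hypergraphical_def uniform_hypergraph_def V_def by blast
  qed
qed

end
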